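(* Consider the saturated switched system $x(t+1)=A_{\sigma(t)}x(t)+B_{\sigma(t)}\,\mathrm{sat}(K_{\sigma(t)}x(t))$, $t\in\mathbb{Z}^+$, with $\sigma(t)\in\mathcal{I}_N=\{1,\dots,N\}$, and let $F_i(x)=A_ix+B_i\,\mathrm{sat}(K_ix)$. Assume that, for some integer $\tau\ge 1$, there exists a collection of symmetric positive definite matrices $P_i\succ 0$, $i\in\mathcal{I}_N$, such that $$F_i(x)^TP_iF_i(x)-x^TP_ix<0\qquad\text{for all }x\neq 0\text{ and all }i\in\mathcal{I}_N,$$ $$F_i^{\tau}(x)^TP_jF_i^{\tau}(x)<x^TP_ix\qquad\text{for all }x\ne 0\text{ and all }(i,j)\in\mathcal{I}_N\times\mathcal{I}_N,\ i\neq j.$$ Then the equilibrium solution $x=0$ of the saturated switched system is globally asymptotically stable with dwell-time $\tau$.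
   Context: Here $x\in\mathbb{R}^n$, $A_i\in\mathbb{R}^{n\times n}$, $B_i\in\mathbb{R}^{n\times m}$, $K_i\in\mathbb{R}^{m\times n}$ for $i\in\mathcal{I}_N$, and $\mathbb{Z}^+$ is the set of non-negative integers. The saturation function $\mathrm{sat}:\mathbb{R}^m\to\mathbb{R}^m$ acts componentwise: $\mathrm{sat}(u)_j=\mathrm{sgn}(u_j)\min\{1,|u_j|\}$. $F_i^{t}$ denotes the $t$-fold composition of $F_i$ with itself. Dwell time: the switching signal $\sigma:\mathbb{Z}^+\to\mathcal{I}_N$ has switching instants $t_0=0<t_1<t_2<\cdots$ (the signal is constant on each $[t_k,t_{k+1})$ and changes value at $t_1,t_2,\dots$). It is dwell-time admissible (DT-admissible) with dwell-time $\tau$ if $t_{k+1}-t_k\ge\tau$ for all $k\in\mathbb{Z}^+$. The origin is (globally/locally) asymptotically stable with dwell-time $\tau$ if it is (globally/locally) asymptotically stable for the system under every switching signal that is DT-admissible with dwell-time $\tau$. Standing assumptions: (A1) for every $i\in\mathcal{I}_N$ all eigenvalues of $A_i+B_iK_i$ lie strictly inside the unit disc; (A2) a value of $\tau\ge1$ has been identified for which the unsaturated switched system $x(t+1)=(A_{\sigma(t)}+B_{\sigma(t)}K_{\sigma(t)})x(t)$ is asymptotically stable with dwell-time $\tau$. *)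

theory Defs
  imports "HOL-Analysis.Analysis"
begin

definition sat :: "real^'m \<Rightarrow> real^'m" where
  "sat u = (\<chi> j. sgn (u $ j) * min 1 \<bar>u $ j\<bar>)"

definition saturated_map :: "real^'n^'n \<Rightarrow> real^'m^'n \<Rightarrow> real^'n^'m \<Rightarrow> real^'n \<Rightarrow> real^'n" where
  "saturated_map A B K x = A *v x + B *v sat (K *v x)"

definition unsaturated_map :: "real^'n^'n \<Rightarrow> real^'m^'n \<Rightarrow> real^'n^'m \<Rightarrow> real^'n \<Rightarrow> real^'n" where
  "unsaturated_map A B K x = (A + B ** K) *v x"

definition sym_pos_def :: "real^'n^'n \<Rightarrow> bool" where
  "sym_pos_def P \<longleftrightarrow> transpose P = P \<and> (\<forall>x. x \<noteq> 0 \<longrightarrow> x \<bullet> (P *v x) > 0)"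

definition eigenvalue :: "real^'n^'n \<Rightarrow> complex \<Rightarrow> bool" where
  "eigenvalue M c \<longleftrightarrow>
     (\<exists>v :: complex^'n. v \<noteq> 0 \<and> map_matrix complex_of_real M *v v = c *s v)"

definition switching_signal :: "'i set \<Rightarrow> (nat \<Rightarrow> 'i) \<Rightarrow> bool" where
  "switching_signal I \<sigma> \<longleftrightarrow> (\<forall>t. \<sigma> t \<in> I)"

text \<open>
  A signal may switch only finitely often (for instance, be constant): the dwell-time condition
  then constrains only the intervals between consecutive switching instants.  Time 0 counts as a
  switching instant, so the first interval has to respect the dwell time as well.
\<close>

definition switching_instants :: "(nat \<Rightarrow> 'i) \<Rightarrow> nat set" where
  "switching_instants \<sigma> = {0} \<union> {Suc t | t. \<sigma> (Suc t) \<noteq> \<sigma> t}"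

definition DT_admissible :: "nat \<Rightarrow> (nat \<Rightarrow> 'i) \<Rightarrow> bool" where
  "DT_admissible \<tau> \<sigma> \<longleftrightarrow>
     (\<forall>s \<in> switching_instants \<sigma>. \<forall>t \<in> switching_instants \<sigma>.
        s < t \<and> {s<..<t} \<inter> switching_instants \<sigma> = {} \<longrightarrow> \<tau> \<le> t - s)"

definition is_trajectory :: "('i \<Rightarrow> 'a \<Rightarrow> 'a) \<Rightarrow> (nat \<Rightarrow> 'i) \<Rightarrow> (nat \<Rightarrow> 'a) \<Rightarrow> bool" where
  "is_trajectory F \<sigma> x \<longleftrightarrow> (\<forall>t. x (Suc t) = F (\<sigma> t) (x t))"

text \<open>
  Stability of the origin is taken for a single switching signal, so that the constants may depend
  on the signal; trajectories start at time 0.  Lyapunov stability as stated entails that the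
  constant 0 sequence is the only trajectory starting at the origin.
\<close>

definition stable ::
  "('i \<Rightarrow> 'a::real_normed_vector \<Rightarrow> 'a) \<Rightarrow> (nat \<Rightarrow> 'i) \<Rightarrow> bool" where
  "stable F \<sigma> \<longleftrightarrow>
     (\<forall>\<epsilon>>0. \<exists>\<delta>>0. \<forall>x. is_trajectory F \<sigma> x \<and> norm (x 0) < \<delta> \<longrightarrow> (\<forall>t. norm (x t) < \<epsilon>))"

definition asymptotically_stable ::
  "('i \<Rightarrow> 'a::real_normed_vector \<Rightarrow> 'a) \<Rightarrow> (nat \<Rightarrow> 'i) \<Rightarrow> bool" where
  "asymptotically_stable F \<sigma> \<longleftrightarrow> stable F \<sigma> \<and>
     (\<exists>\<delta>>0. \<forall>x. is_trajectory F \<sigma> x \<and> norm (x 0) < \<delta> \<longrightarrow> x \<longlonglongrightarrow> 0)"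

definition globally_asymptotically_stable ::
  "('i \<Rightarrow> 'a::real_normed_vector \<Rightarrow> 'a) \<Rightarrow> (nat \<Rightarrow> 'i) \<Rightarrow> bool" where
  "globally_asymptotically_stable F \<sigma> \<longleftrightarrow> stable F \<sigma> \<and>
     (\<forall>x. is_trajectory F \<sigma> x \<longrightarrow> x \<longlonglongrightarrow> 0)"

definition asymptotically_stable_with_dwell_time ::
  "'i set \<Rightarrow> ('i \<Rightarrow> 'a::real_normed_vector \<Rightarrow> 'a) \<Rightarrow> nat \<Rightarrow> bool" where
  "asymptotically_stable_with_dwell_time I F \<tau> \<longleftrightarrow>
     (\<forall>\<sigma>. switching_signal I \<sigma> \<and> DT_admissible \<tau> \<sigma> \<longrightarrow> asymptotically_stable F \<sigma>)"

definition globally_asymptotically_stable_with_dwell_time ::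
  "'i set \<Rightarrow> ('i \<Rightarrow> 'a::real_normed_vector \<Rightarrow> 'a) \<Rightarrow> nat \<Rightarrow> bool" where
  "globally_asymptotically_stable_with_dwell_time I F \<tau> \<longleftrightarrow>
     (\<forall>\<sigma>. switching_signal I \<sigma> \<and> DT_admissible \<tau> \<sigma> \<longrightarrow> globally_asymptotically_stable F \<sigma>)"

end

theory Submission
  imports Defs
begin

text \<open>
  Each mode \<open>i\<close> carries its own Lyapunov function \<open>V i x = x \<bullet> (P i *v x)\<close>, and along a
  trajectory outside the origin one watches the value \<open>V (\<sigma> t) (x t)\<close> of the function of the active mode.  This value
  decreases while the mode stays the same, but it may jump up at a switch.  Call a time \<open>t\<close> settled
  if the mode active at \<open>t\<close> stays active up to time \<open>t + \<tau> - 1\<close>; every switching instant, and in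
  particular time 0, is settled.  From a settled time \<open>t\<close> one reaches another settled time in one of
  two ways.  Either the mode is still the same at \<open>t + \<tau>\<close>, and then \<open>t + 1\<close> is settled, or the mode
  changes at \<open>t + \<tau>\<close>, which is then a switching instant and therefore settled.  The first of the two
  Lyapunov inequalities makes the watched value decrease over a move of the first kind, the second
  one does so over a move of the second kind.  Between two settled times the mode does not change,
  so that the value at a settled time dominates all later values (\<open>value_le_settled\<close>).  At time 0
  this is Lyapunov stability.

  For attractivity, as long as the values at settled times stay above some \<open>L > 0\<close>, the
  corresponding states stay in a compact set that avoids the origin.  By continuity of the maps and
  finiteness of the number of modes, every move then decreases the value by at least a fixed amount
  (\<open>uniform_decrease\<close>), which cannot go on forever.  Hence the values at settled times come
  arbitrarily close to 0 (\<open>settled_value_small\<close>), and since they dominate all later values, the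
  trajectory converges to the origin.
\<close>

section \<open>Uniform constants over finitely many modes\<close>

lemma finite_uniform_positive:
  fixes Q :: "'i \<Rightarrow> real \<Rightarrow> bool"
  assumes "finite I"
    and "\<And>i. i \<in> I \<Longrightarrow> \<exists>e>0. Q i e"
    and mono: "\<And>i d e. i \<in> I \<Longrightarrow> Q i e \<Longrightarrow> d \<le> e \<Longrightarrow> Q i d"
  shows "\<exists>e>0. \<forall>i\<in>I. Q i e"
proof -
  obtain f where f: "\<And>i. i \<in> I \<Longrightarrow> f i > 0 \<and> Q i (f i)"
    using assms(2) by metis
  \<comment> \<open>The extra element 1 covers an empty index set.\<close>
  define e where "e = Min (insert 1 (f ` I))"
  have "e > 0"
    unfolding e_def using assms(1) f by (subst Min_gr_iff) auto
  moreover have "Q i e" if "i \<in> I" for i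
  proof -
    have "e \<le> f i"
      unfolding e_def using assms(1) that by (intro Min_le) auto
    then show ?thesis
      using mono f that by blast
  qed
  ultimately show ?thesis by blast
qed

section \<open>Multiple Lyapunov functions under a dwell-time constraint\<close>

definition settled :: "nat \<Rightarrow> (nat \<Rightarrow> 'i) \<Rightarrow> nat \<Rightarrow> bool" where
  "settled \<tau> \<sigma> t \<longleftrightarrow> (\<forall>s<\<tau>. \<sigma> (t + s) = \<sigma> t)"

text \<open>
  The first failure of constancy after a switching instant is the next switching instant, and the
  dwell time keeps it at distance at least \<open>\<tau>\<close>.
\<close>

lemma switching_instant_settled:
  assumes DT: "DT_admissible \<tau> \<sigma>" and t: "t \<in> switching_instants \<sigma>"
  shows "settled \<tau> \<sigma> t"
proof (rule ccontr)
  assume "\<not> settled \<tau> \<sigma> t"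
  then obtain s where s: "s < \<tau>" "\<sigma> (t + s) \<noteq> \<sigma> t"
    by (auto simp: settled_def)
  define u where "u = (LEAST s. \<sigma> (t + s) \<noteq> \<sigma> t)"
  have u: "\<sigma> (t + u) \<noteq> \<sigma> t" and u_le: "u \<le> s"
    unfolding u_def using s(2) by (rule LeastI, rule Least_le)
  have before: "\<sigma> (t + v) = \<sigma> t" if "v < u" for v
    using not_less_Least[of v "\<lambda>s. \<sigma> (t + s) \<noteq> \<sigma> t"] that u_def by auto
  obtain v where v: "u = Suc v"
    using u by (cases u) auto
  have "t + u \<in> switching_instants \<sigma>"
    using u before[of v] v by (auto simp: switching_instants_def)
  moreover have "{t<..<t + u} \<inter> switching_instants \<sigma> = {}"
  proof -
    have False if w: "t < w" "w < t + u" "w \<in> switching_instants \<sigma>" for w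
    proof -
      obtain r where r: "w = Suc r" "\<sigma> (Suc r) \<noteq> \<sigma> r"
        using w by (auto simp: switching_instants_def)
      have "\<sigma> (t + (r - t)) = \<sigma> t" "\<sigma> (t + (Suc r - t)) = \<sigma> t"
        using w r before[of "r - t"] before[of "Suc r - t"] by simp_all
      then show False
        using w r by auto
    qed
    then show ?thesis by auto
  qed
  ultimately have "\<tau> \<le> u"
    using DT t v unfolding DT_admissible_def by fastforce
  then show False
    using u_le s(1) by simp
qed

text \<open>
  The quadratic lower bound on the functions \<open>V i\<close> turns small values into small norms and makes
  their sublevel sets bounded.  The constant \<open>a\<close> is
  common to all modes because the active one changes along a trajectory.
\<close>

locale dwell_time_lyapunov =
  fixes I :: "'i set"
    and F :: "'i \<Rightarrow> 'a::euclidean_space \<Rightarrow> 'a"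
    and V :: "'i \<Rightarrow> 'a \<Rightarrow> real"
    and \<tau> :: nat
    and a :: real
  assumes finite_modes: "finite I"
    and dwell_pos: "\<tau> \<ge> 1"
    and F_cont: "\<And>i. i \<in> I \<Longrightarrow> continuous_on UNIV (F i)"
    and F_zero: "\<And>i. i \<in> I \<Longrightarrow> F i 0 = 0"
    and V_cont: "\<And>i. i \<in> I \<Longrightarrow> continuous_on UNIV (V i)"
    and V_zero: "\<And>i. i \<in> I \<Longrightarrow> V i 0 = 0"
    and coercive_pos: "a > 0"
    and V_coercive: "\<And>i x. i \<in> I \<Longrightarrow> a * (norm x)\<^sup>2 \<le> V i x"
    and V_step: "\<And>i x. i \<in> I \<Longrightarrow> x \<noteq> 0 \<Longrightarrow> V i (F i x) < V i x"
    and V_switch: "\<And>i j x. i \<in> I \<Longrightarrow> j \<in> I \<Longrightarrow> i \<noteq> j \<Longrightarrow> x \<noteq> 0 \<Longrightarrow>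
          V j ((F i ^^ \<tau>) x) < V i x"
begin

text \<open>
  The flow from a settled time in mode \<open>i\<close> to the next one, in mode \<open>j\<close>.  With it both Lyapunov
  inequalities become the single inequality \<open>move_less\<close>.
\<close>

definition move :: "'i \<Rightarrow> 'i \<Rightarrow> 'a \<Rightarrow> 'a" where
  "move i j = (if i = j then F i else F i ^^ \<tau>)"

lemma move_less:
  assumes "i \<in> I" "j \<in> I" "x \<noteq> 0"
  shows "V j (move i j x) < V i x"
  using assms V_step V_switch by (auto simp: move_def)

lemma funpow_zero: "i \<in> I \<Longrightarrow> (F i ^^ n) 0 = 0"
  by (induction n) (auto simp: F_zero)

lemma move_le:
  assumes "i \<in> I" "j \<in> I"
  shows "V j (move i j x) \<le> V i x"
proof (cases "x = 0")
  case True
  then show ?thesis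
    using assms by (simp add: move_def F_zero funpow_zero V_zero)
qed (use move_less assms in \<open>auto intro: less_imp_le\<close>)

lemma funpow_le:
  assumes "i \<in> I"
  shows "V i ((F i ^^ n) x) \<le> V i x"
proof (induction n)
  case (Suc n)
  have "V i (F i ((F i ^^ n) x)) \<le> V i ((F i ^^ n) x)"
    using move_le[OF assms assms] by (simp add: move_def)
  with Suc show ?case by simp
qed simp

lemma funpow_cont: "i \<in> I \<Longrightarrow> continuous_on UNIV (F i ^^ n)"
proof (induction n)
  case (Suc n)
  then show ?case
    unfolding funpow.simps
    by (intro continuous_on_compose) (auto intro: continuous_on_subset[OF F_cont])
qed (auto simp: id_def)

lemma move_cont: "i \<in> I \<Longrightarrow> continuous_on UNIV (move i j)"
  using F_cont funpow_cont by (auto simp: move_def)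

lemma V_nonneg: "i \<in> I \<Longrightarrow> 0 \<le> V i x"
  using V_coercive[of i x] coercive_pos by (smt (verit) mult_nonneg_nonneg zero_le_power2)

text \<open>
  A shell \<open>L \<le> V i x \<le> R\<close> is closed, bounded by coercivity, and avoids the origin.  So the
  continuous positive decrease attains a positive minimum on it, and there are only finitely many
  pairs of modes.
\<close>

lemma uniform_decrease:
  assumes "L > 0"
  shows "\<exists>\<eta>>0. \<forall>i\<in>I. \<forall>j\<in>I. \<forall>x. L \<le> V i x \<and> V i x \<le> R \<longrightarrow> V j (move i j x) \<le> V i x - \<eta>"
proof -
  have pair: "\<exists>\<eta>>0. \<forall>x. L \<le> V i x \<and> V i x \<le> R \<longrightarrow> V j (move i j x) \<le> V i x - \<eta>"
    if i: "i \<in> I" and j: "j \<in> I" for i j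
  proof -
    define C where "C = {x. L \<le> V i x \<and> V i x \<le> R}"
    have "closed C"
      unfolding C_def
      by (intro closed_Collect_conj closed_Collect_le V_cont[OF i] continuous_on_const)
    moreover have "bounded C"
      unfolding bounded_iff
    proof (intro exI ballI)
      fix x assume "x \<in> C"
      then have "a * (norm x)\<^sup>2 \<le> R"
        using V_coercive[OF i, of x] by (auto simp: C_def)
      then have "(norm x)\<^sup>2 \<le> R / a"
        using coercive_pos by (simp add: field_simps)
      then show "norm x \<le> sqrt (R / a)"
        by (rule real_le_rsqrt)
    qed
    ultimately have "compact C"
      by (simp add: compact_eq_bounded_closed)
    have nonzero: "x \<noteq> 0" if "x \<in> C" for x
      using that assms V_zero[OF i] by (auto simp: C_def)
    show ?thesis
    proof (cases "C = {}")
      case True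
      then show ?thesis
        by (intro exI[of _ 1]) (auto simp: C_def)
    next
      case False
      have "continuous_on UNIV (\<lambda>x. V j (move i j x))"
        using continuous_on_compose2[OF V_cont[OF j] move_cont[OF i]] by simp
      then have "continuous_on C (\<lambda>x. V i x - V j (move i j x))"
        using V_cont[OF i] by (intro continuous_on_diff) (auto intro: continuous_on_subset)
      then obtain u where u: "u \<in> C"
        "\<And>x. x \<in> C \<Longrightarrow> V i u - V j (move i j u) \<le> V i x - V j (move i j x)"
        using continuous_attains_inf[OF \<open>compact C\<close> False] by blast
      have "V i u - V j (move i j u) > 0"
        using move_less[OF i j nonzero[OF u(1)]] by simp
      moreover have "V j (move i j x) \<le> V i x - (V i u - V j (move i j u))"
        if "L \<le> V i x \<and> V i x \<le> R" for x
        using u(2)[of x] that by (simp add: C_def)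
      ultimately show ?thesis by blast
    qed
  qed
  have "\<exists>\<eta>>0. \<forall>p\<in>I \<times> I. \<forall>x. L \<le> V (fst p) x \<and> V (fst p) x \<le> R
      \<longrightarrow> V (snd p) (move (fst p) (snd p) x) \<le> V (fst p) x - \<eta>"
  proof (rule finite_uniform_positive)
    show "finite (I \<times> I)"
      using finite_modes by simp
  next
    fix p assume "p \<in> I \<times> I"
    then show "\<exists>\<eta>>0. \<forall>x. L \<le> V (fst p) x \<and> V (fst p) x \<le> R
        \<longrightarrow> V (snd p) (move (fst p) (snd p) x) \<le> V (fst p) x - \<eta>"
      using pair[of "fst p" "snd p"] by (simp add: mem_Times_iff)
  next
    fix p d e
    assume "\<forall>x. L \<le> V (fst p) x \<and> V (fst p) x \<le> R
        \<longrightarrow> V (snd p) (move (fst p) (snd p) x) \<le> V (fst p) x - e" "d \<le> e"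
    then show "\<forall>x. L \<le> V (fst p) x \<and> V (fst p) x \<le> R
        \<longrightarrow> V (snd p) (move (fst p) (snd p) x) \<le> V (fst p) x - d"
      by (smt (verit))
  qed
  then show ?thesis by auto
qed

end

locale dwell_time_trajectory = dwell_time_lyapunov I F V \<tau> a
  for I :: "'i set" and F :: "'i \<Rightarrow> 'a::euclidean_space \<Rightarrow> 'a"
    and V :: "'i \<Rightarrow> 'a \<Rightarrow> real" and \<tau> :: nat and a :: real +
  fixes \<sigma> :: "nat \<Rightarrow> 'i" and x :: "nat \<Rightarrow> 'a"
  assumes signal: "switching_signal I \<sigma>"
    and admissible: "DT_admissible \<tau> \<sigma>"
    and trajectory: "is_trajectory F \<sigma> x"
begin

definition active_value :: "nat \<Rightarrow> real" where
  "active_value t = V (\<sigma> t) (x t)"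

lemma mode: "\<sigma> t \<in> I"
  using signal by (simp add: switching_signal_def)

lemma flow_in_mode:
  assumes "settled \<tau> \<sigma> t" "s \<le> \<tau>"
  shows "x (t + s) = (F (\<sigma> t) ^^ s) (x t)"
  using assms(2)
proof (induction s)
  case (Suc s)
  then show ?case
    using assms(1) trajectory by (simp add: settled_def is_trajectory_def)
qed simp

lemma settled_zero: "settled \<tau> \<sigma> 0"
  using admissible by (rule switching_instant_settled) (simp add: switching_instants_def)

text \<open>
  The case distinction is whether the mode persists at \<open>t + \<tau>\<close>: if so, \<open>t'\<close> is the next instant;
  otherwise \<open>t + \<tau>\<close> is a switching instant, and the stay in the old mode lasts for exactly \<open>\<tau>\<close>
  steps after \<open>t\<close>.
\<close>

lemma next_settled:
  assumes "settled \<tau> \<sigma> t"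
  obtains t' where "settled \<tau> \<sigma> t'" "t < t'" "t' \<le> t + \<tau>" "x t' = move (\<sigma> t) (\<sigma> t') (x t)"
proof (cases "\<sigma> (t + \<tau>) = \<sigma> t")
  case True
  then have const: "\<sigma> (t + s) = \<sigma> t" if "s \<le> \<tau>" for s
    using assms that by (cases "s = \<tau>") (auto simp: settled_def)
  have "\<sigma> (Suc t) = \<sigma> t"
    using const[of 1] dwell_pos by simp
  then have "x (Suc t) = move (\<sigma> t) (\<sigma> (Suc t)) (x t)"
    using trajectory by (simp add: is_trajectory_def move_def)
  moreover have "settled \<tau> \<sigma> (Suc t)"
    unfolding settled_def
  proof (intro allI impI)
    fix s assume "s < \<tau>"
    then show "\<sigma> (Suc t + s) = \<sigma> (Suc t)"
      using const[of "Suc s"] \<open>\<sigma> (Suc t) = \<sigma> t\<close> by simp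
  qed
  ultimately show ?thesis
    using that[of "Suc t"] dwell_pos by simp
next
  case False
  have "\<sigma> (t + (\<tau> - 1)) = \<sigma> t"
    using assms dwell_pos unfolding settled_def by (auto dest: spec[of _ "\<tau> - 1"])
  moreover have "Suc (t + (\<tau> - 1)) = t + \<tau>"
    using dwell_pos by simp
  ultimately have "t + \<tau> \<in> switching_instants \<sigma>"
    using False unfolding switching_instants_def by (metis (mono_tags, lifting) UnI2 mem_Collect_eq)
  then have "settled \<tau> \<sigma> (t + \<tau>)"
    by (rule switching_instant_settled[OF admissible])
  moreover have "x (t + \<tau>) = move (\<sigma> t) (\<sigma> (t + \<tau>)) (x t)"
    using flow_in_mode[OF assms, of \<tau>] False by (simp add: move_def)
  ultimately show ?thesis
    using that[of "t + \<tau>"] dwell_pos by simp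
qed

text \<open>
  Values at switches in between need no separate treatment: a later time is either reached within
  the current mode before the next settled time, or it is dominated by the value there.
\<close>

lemma value_le_settled:
  assumes "settled \<tau> \<sigma> t" "t \<le> r"
  shows "active_value r \<le> active_value t"
  using assms
proof (induction "r - t" arbitrary: t rule: less_induct)
  case less
  obtain t' where t': "settled \<tau> \<sigma> t'" "t < t'" "t' \<le> t + \<tau>"
    and move: "x t' = move (\<sigma> t) (\<sigma> t') (x t)"
    using next_settled[OF less.prems(1)] .
  show ?case
  proof (cases "t' \<le> r")
    case True
    then have "active_value r \<le> active_value t'"
      using less t' by auto
    also have "\<dots> \<le> active_value t"
      using move_le[OF mode mode] by (simp add: active_value_def move)
    finally show ?thesis .
  next
    case False
    define s where "s = r - t"
    have s: "r = t + s" "s < \<tau>"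
      using False less.prems(2) t' by (auto simp: s_def)
    have "\<sigma> r = \<sigma> t" "x r = (F (\<sigma> t) ^^ s) (x t)"
      using less.prems(1) s flow_in_mode[of t s] by (auto simp: settled_def)
    then show ?thesis
      using funpow_le[OF mode] by (simp add: active_value_def)
  qed
qed

lemma norm_less_of_active_value:
  assumes "active_value t < a * \<epsilon>\<^sup>2" "\<epsilon> > 0"
  shows "norm (x t) < \<epsilon>"
proof -
  have "a * (norm (x t))\<^sup>2 < a * \<epsilon>\<^sup>2"
    using V_coercive[OF mode, of "x t" t] assms(1) by (simp add: active_value_def)
  then have "(norm (x t))\<^sup>2 < \<epsilon>\<^sup>2"
    using coercive_pos by simp
  then show ?thesis
    using assms(2) power2_less_imp_less[of "norm (x t)" \<epsilon>] by simp
qed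

lemma settled_value_small:
  assumes "L > 0"
  shows "\<exists>t. settled \<tau> \<sigma> t \<and> active_value t < L"
proof (rule ccontr)
  assume "\<nexists>t. settled \<tau> \<sigma> t \<and> active_value t < L"
  then have above: "L \<le> active_value t" if "settled \<tau> \<sigma> t" for t
    using that by (meson not_less)
  obtain \<eta> where "\<eta> > 0" and \<eta>: "\<And>i j y. i \<in> I \<Longrightarrow> j \<in> I \<Longrightarrow> L \<le> V i y \<Longrightarrow>
      V i y \<le> active_value 0 \<Longrightarrow> V j (move i j y) \<le> V i y - \<eta>"
    using uniform_decrease[OF assms, of "active_value 0"] by blast
  have descent: "\<exists>t. settled \<tau> \<sigma> t \<and> active_value t \<le> active_value 0 - real k * \<eta>" for k
  proof (induction k)
    case 0
    then show ?case using settled_zero by auto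
  next
    case (Suc k)
    then obtain t where t: "settled \<tau> \<sigma> t" "active_value t \<le> active_value 0 - real k * \<eta>"
      by blast
    obtain t' where t': "settled \<tau> \<sigma> t'" "x t' = move (\<sigma> t) (\<sigma> t') (x t)"
      using next_settled[OF t(1)] by metis
    have "active_value t' \<le> active_value t - \<eta>"
      using \<eta>[OF mode mode, of t "x t" t'] above[OF t(1)]
        value_le_settled[OF settled_zero, of t] t'(2) by (simp add: active_value_def)
    then show ?case
      using t t' by (auto simp: algebra_simps)
  qed
  obtain k where "active_value 0 < real k * \<eta>"
    using reals_Archimedean3[OF \<open>\<eta> > 0\<close>] by blast
  moreover obtain t where "active_value t \<le> active_value 0 - real k * \<eta>"
    using descent by blast
  moreover have "0 \<le> active_value t"
    by (simp add: active_value_def V_nonneg mode)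
  ultimately show False by simp
qed

lemma converges_to_zero: "x \<longlonglongrightarrow> 0"
proof (rule LIMSEQ_I)
  fix \<epsilon> :: real assume "\<epsilon> > 0"
  then obtain t where "settled \<tau> \<sigma> t" "active_value t < a * \<epsilon>\<^sup>2"
    using settled_value_small[of "a * \<epsilon>\<^sup>2"] coercive_pos by auto
  then have "norm (x r) < \<epsilon>" if "t \<le> r" for r
    using value_le_settled[of t r] that \<open>\<epsilon> > 0\<close> by (intro norm_less_of_active_value) auto
  then show "\<exists>t. \<forall>r\<ge>t. norm (x r - 0) < \<epsilon>" by auto
qed

end

context dwell_time_lyapunov
begin

text \<open>
  For stability only the initial mode matters: all values are dominated by the one at time 0, which
  is small for small initial states by continuity of \<open>V (\<sigma> 0)\<close> at the origin.
\<close>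

theorem globally_asymptotically_stable_dwell_time:
  "globally_asymptotically_stable_with_dwell_time I F \<tau>"
  unfolding globally_asymptotically_stable_with_dwell_time_def
proof (intro allI impI)
  fix \<sigma> assume \<sigma>: "switching_signal I \<sigma> \<and> DT_admissible \<tau> \<sigma>"
  have trajectory: "dwell_time_trajectory I F V \<tau> a \<sigma> x" if "is_trajectory F \<sigma> x" for x
    using \<sigma> that by unfold_locales auto
  have "stable F \<sigma>"
    unfolding stable_def
  proof (intro allI impI)
    fix \<epsilon> :: real assume "\<epsilon> > 0"
    have init: "\<sigma> 0 \<in> I"
      using \<sigma> by (simp add: switching_signal_def)
    have "isCont (V (\<sigma> 0)) 0"
      using V_cont[OF init] by (simp add: continuous_on_eq_continuous_at)
    moreover have "a * \<epsilon>\<^sup>2 > 0"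
      using coercive_pos \<open>\<epsilon> > 0\<close> by simp
    ultimately obtain \<delta> where "\<delta> > 0"
      and \<delta>: "\<And>y. dist y 0 < \<delta> \<Longrightarrow> dist (V (\<sigma> 0) y) (V (\<sigma> 0) 0) < a * \<epsilon>\<^sup>2"
      unfolding continuous_at_eps_delta by blast
    have "norm (x t) < \<epsilon>" if x: "is_trajectory F \<sigma> x" "norm (x 0) < \<delta>" for x t
    proof -
      interpret dwell_time_trajectory I F V \<tau> a \<sigma> x
        using trajectory x(1) .
      have "active_value t \<le> V (\<sigma> 0) (x 0)"
        using value_le_settled[OF settled_zero, of t] by (simp add: active_value_def)
      also have "\<dots> < a * \<epsilon>\<^sup>2"
        using \<delta>[of "x 0"] x(2) V_zero[OF init] by (simp add: dist_real_def)
      finally show ?thesis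
        using \<open>\<epsilon> > 0\<close> by (rule norm_less_of_active_value)
    qed
    then show "\<exists>\<delta>>0. \<forall>x. is_trajectory F \<sigma> x \<and> norm (x 0) < \<delta> \<longrightarrow> (\<forall>t. norm (x t) < \<epsilon>)"
      using \<open>\<delta> > 0\<close> by blast
  qed
  then show "globally_asymptotically_stable F \<sigma>"
    using dwell_time_trajectory.converges_to_zero[OF trajectory]
    by (simp add: globally_asymptotically_stable_def)
qed

end

section \<open>Quadratic forms and saturated maps\<close>

lemma quadratic_form_cont:
  fixes P :: "real^'n^'n"
  shows "continuous_on S (\<lambda>x. x \<bullet> (P *v x))"
  by (intro continuous_on_inner continuous_on_id linear_continuous_on
      linear_conv_bounded_linear[THEN iffD1] matrix_vector_mul_linear)

text \<open>
  The constant is the minimum of the form on the unit sphere; homogeneity carries the bound over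
  to the whole space.
\<close>

lemma sym_pos_def_coercive:
  fixes P :: "real^'n^'n"
  assumes "sym_pos_def P"
  shows "\<exists>a>0. \<forall>x. a * (norm x)\<^sup>2 \<le> x \<bullet> (P *v x)"
proof -
  have "(axis undefined 1 :: real^'n) \<in> sphere 0 1"
    by (simp add: norm_axis_1)
  then obtain u :: "real^'n" where u: "u \<in> sphere 0 1"
    "\<And>x. x \<in> sphere 0 1 \<Longrightarrow> u \<bullet> (P *v u) \<le> x \<bullet> (P *v x)"
    using continuous_attains_inf[OF compact_sphere _ quadratic_form_cont, of 0 1 P] by blast
  have "u \<bullet> (P *v u) * (norm x)\<^sup>2 \<le> x \<bullet> (P *v x)" for x
  proof (cases "x = 0")
    case False
    have "x \<bullet> (P *v x) = (norm x *\<^sub>R sgn x) \<bullet> (P *v (norm x *\<^sub>R sgn x))"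
      using False by (simp add: sgn_div_norm)
    also have "\<dots> = (norm x)\<^sup>2 * (sgn x \<bullet> (P *v sgn x))"
      by (simp only: matrix_vector_mult_scaleR inner_scaleR_left inner_scaleR_right
          power2_eq_square mult.assoc)
    finally have eq: "x \<bullet> (P *v x) = (norm x)\<^sup>2 * (sgn x \<bullet> (P *v sgn x))" .
    have "u \<bullet> (P *v u) \<le> sgn x \<bullet> (P *v sgn x)"
      using u(2)[of "sgn x"] False by (simp add: norm_sgn)
    then show ?thesis
      unfolding eq by (subst mult.commute) (rule mult_left_mono, auto)
  qed simp
  moreover have "u \<bullet> (P *v u) > 0"
    using assms u(1) unfolding sym_pos_def_def by (metis mem_sphere_0 norm_zero zero_neq_one)
  ultimately show ?thesis by blast
qed

text \<open>
  Written with clamps instead of \<open>sgn\<close>, which is discontinuous, the saturation is visibly continuous.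
\<close>

lemma sat_eq_clamp: "sat u = (\<chi> j. max (- 1) (min 1 (u $ j)))"
  by (auto simp: sat_def vec_eq_iff sgn_real_def min_def max_def)

lemma saturated_map_cont: "continuous_on S (saturated_map A B K)"
proof -
  have linear: "continuous_on T ((*v) M)" for M :: "real^'p^'q" and T
    by (intro linear_continuous_on linear_conv_bounded_linear[THEN iffD1] matrix_vector_mul_linear)
  have sat: "continuous_on T (sat :: real^'m \<Rightarrow> real^'m)" for T
    unfolding sat_eq_clamp
    by (intro continuous_on_vec_lambda continuous_intros)
  show ?thesis
    unfolding saturated_map_def
    by (intro continuous_on_add continuous_on_compose2[OF linear[of UNIV]]
        continuous_on_compose2[OF sat[of UNIV]] linear) auto
qed

lemma saturated_map_zero: "saturated_map A B K 0 = 0"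
  by (simp add: saturated_map_def sat_def vec_eq_iff matrix_vector_mult_def)

section \<open>Global asymptotic stability of the saturated switched system\<close>

theorem theorem1:
  fixes N :: nat
    and A :: "nat \<Rightarrow> real^'n^'n"
    and B :: "nat \<Rightarrow> real^'m^'n"
    and K :: "nat \<Rightarrow> real^'n^'m"
    and P :: "nat \<Rightarrow> real^'n^'n"
    and F :: "nat \<Rightarrow> real^'n \<Rightarrow> real^'n"
    and \<tau> :: nat
  defines "F \<equiv> \<lambda>i. saturated_map (A i) (B i) (K i)"
  assumes A1: "\<And>i c. i \<in> {1..N} \<Longrightarrow> eigenvalue (A i + B i ** K i) c \<Longrightarrow> cmod c < 1"
    and A2: "\<exists>\<tau>\<^sub>0\<ge>1. asymptotically_stable_with_dwell_time {1..N}
               (\<lambda>i. unsaturated_map (A i) (B i) (K i)) \<tau>\<^sub>0"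
    and "\<tau> \<ge> 1"
    and "\<And>i. i \<in> {1..N} \<Longrightarrow> sym_pos_def (P i)"
    and "\<And>i x. i \<in> {1..N} \<Longrightarrow> x \<noteq> 0 \<Longrightarrow>
           F i x \<bullet> (P i *v F i x) - x \<bullet> (P i *v x) < 0"
    and "\<And>i j x. i \<in> {1..N} \<Longrightarrow> j \<in> {1..N} \<Longrightarrow> i \<noteq> j \<Longrightarrow> x \<noteq> 0 \<Longrightarrow>
           (F i ^^ \<tau>) x \<bullet> (P j *v (F i ^^ \<tau>) x) < x \<bullet> (P i *v x)"
  shows "globally_asymptotically_stable_with_dwell_time {1..N} F \<tau>"
proof -
  note pos_def = assms(5) and step = assms(6) and switch = assms(7)
  have "\<exists>a>0. \<forall>i\<in>{1..N}. \<forall>x. a * (norm x)\<^sup>2 \<le> x \<bullet> (P i *v x)"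
  proof (rule finite_uniform_positive)
    fix i d e
    assume "\<forall>x. e * (norm x)\<^sup>2 \<le> x \<bullet> (P i *v x)" "d \<le> e"
    then show "\<forall>x. d * (norm x)\<^sup>2 \<le> x \<bullet> (P i *v x)"
      by (meson mult_right_mono order_trans zero_le_power2)
  qed (use pos_def sym_pos_def_coercive in auto)
  then obtain a where a: "a > 0" "\<And>i x. i \<in> {1..N} \<Longrightarrow> a * (norm x)\<^sup>2 \<le> x \<bullet> (P i *v x)"
    by blast
  interpret dwell_time_lyapunov "{1..N}" F "\<lambda>i x. x \<bullet> (P i *v x)" \<tau> a
  proof unfold_locales
    show "continuous_on UNIV (F i)" "F i 0 = 0" for i
      by (simp_all add: F_def saturated_map_cont saturated_map_zero)
    show "F i x \<bullet> (P i *v F i x) < x \<bullet> (P i *v x)" if "i \<in> {1..N}" "x \<noteq> 0" for i x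
      using step[OF that] by simp
  qed (use a switch \<open>\<tau> \<ge> 1\<close> in \<open>auto intro: quadratic_form_cont\<close>)
  show ?thesis
    by (rule globally_asymptotically_stable_dwell_time)
qed

end
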